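(* There exists a finitely presented monoid $S$ whose right Cayley graph (with respect to a finite generating set of $S$) is not quasi-simply-connected.
   Context: A monoid is finitely presented if it is defined by some presentation $\langle A\mid R\rangle$ with $A$, $R$ finite. For a monoid $S$ generated by a finite set $A$, the right Cayley graph $\Gamma_r(S,A)$ is the directed graph with vertex set $S$ and an edge from $x$ to $y$ if and only if $xa=y$ for some $a\in A$. Let $\Gamma$ be a directed graph. Directed paths (including empty paths, one at each vertex) are called $1$-paths; $|p|$ denotes the length of $p$. Two paths $p,q$ are parallel, $p\parallel q$, if they have the same start vertex and the same end vertex. For $n\in\mathbb{N}$, $K_n(\Gamma)$ is the directed $2$-complex on $\Gamma$ whose $2$-cells are the pairs $f=(p,q)$ of parallel paths in $\Gamma$ with $|p|+|q|\le n$, with top $\lceil f\rceil=p$, bottom $\lfloor f\rfloor=q$, and inverse $(q,p)$. An atomic $2$-path is a triple $\delta=(u,f,v)$ with $u,v$ paths in $\Gamma$ and $f$ a $2$-cell such that $u$ ends where $\lceil f\rceil$ starts and $v$ starts where $\lceil f\rceil$ ends; its top is $\lceil\delta\rceil=u\lceil f\rceil v$ and its bottom is $\lfloor\delta\rfloor=u\lfloor f\rfloor v$. A $2$-path from $p$ to $q$ is a finite sequence of atomic $2$-paths $\delta_1,\dots,\delta_k$ with $\lceil\delta_1\rceil=p$, $\lfloor\delta_i\rfloor=\lceil\delta_{i+1}\rceil$ for $1\le i<k$, and $\lfloor\delta_k\rfloor=q$. $K_n(\Gamma)$ is directed simply connected if for every pair of parallel paths $p\parallel q$ in $\Gamma$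 there is a $2$-path from $p$ to $q$. $\Gamma$ is $n$-quasi-simply-connected if $K_n(\Gamma)$ is directed simply connected, and quasi-simply-connected if it is $n$-quasi-simply-connected for some $n\in\mathbb{N}$. *)

theory Defs
  imports "HOL-Algebra.Group" "HOL.Hull" "Graph_Theory.Arc_Walk"
begin

section \<open>Monoid presentations\<close>

text \<open>The congruence on the free monoid \<open>lists A\<close> generated by the relations \<open>R\<close>.\<close>

inductive_set presentation_cong :: "'g set \<Rightarrow> ('g list \<times> 'g list) set \<Rightarrow> ('g list \<times> 'g list) set"
  for A :: "'g set" and R :: "('g list \<times> 'g list) set"
where
  base: "(u, v) \<in> R \<Longrightarrow> (u, v) \<in> presentation_cong A R"
| refl: "u \<in> lists A \<Longrightarrow> (u, u) \<in> presentation_cong A R"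
| sym: "(u, v) \<in> presentation_cong A R \<Longrightarrow> (v, u) \<in> presentation_cong A R"
| trans: "\<lbrakk>(u, v) \<in> presentation_cong A R; (v, w) \<in> presentation_cong A R\<rbrakk>
    \<Longrightarrow> (u, w) \<in> presentation_cong A R"
| compat: "\<lbrakk>(u, v) \<in> presentation_cong A R; x \<in> lists A; y \<in> lists A\<rbrakk>
    \<Longrightarrow> (x @ u @ y, x @ v @ y) \<in> presentation_cong A R"

definition presented_monoid :: "'g set \<Rightarrow> ('g list \<times> 'g list) set \<Rightarrow> 'g list set monoid" where
  "presented_monoid A R =
    \<lparr>carrier = lists A // presentation_cong A R,
     mult = (\<lambda>X Y. \<Union>x\<in>X. \<Union>y\<in>Y. presentation_cong A R `` {x @ y}),
     one = presentation_cong A R `` {[]}\<rparr>"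

definition defined_by_presentation ::
  "('a, 'm) monoid_scheme \<Rightarrow> 'g set \<Rightarrow> ('g list \<times> 'g list) set \<Rightarrow> bool" where
  "defined_by_presentation S A R \<longleftrightarrow>
    monoid S \<and> R \<subseteq> lists A \<times> lists A \<and> S \<cong> presented_monoid A R"

text \<open>The letters of a finite alphabet can be renamed, so it is no restriction to take
  them to be natural numbers.\<close>

definition finitely_presented :: "('a, 'm) monoid_scheme \<Rightarrow> bool" where
  "finitely_presented S \<longleftrightarrow>
    (\<exists>(A :: nat set) R. finite A \<and> finite R \<and> defined_by_presentation S A R)"

definition generates_monoid :: "('a, 'm) monoid_scheme \<Rightarrow> 'a set \<Rightarrow> bool" where
  "generates_monoid S A \<longleftrightarrow>
    A \<subseteq> carrier S \<and> (\<lambda>H. submonoid H S) hull A = carrier S"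

text \<open>An arc is an ordered pair of vertices: different generators leading from \<open>x\<close> to the
  same \<open>y\<close> give only one arc.\<close>

definition right_cayley_graph ::
  "('a, 'm) monoid_scheme \<Rightarrow> 'a set \<Rightarrow> ('a, 'a \<times> 'a) pre_digraph" where
  "right_cayley_graph S A =
    \<lparr>verts = carrier S,
     arcs = {(x, y). x \<in> carrier S \<and> y \<in> carrier S \<and> (\<exists>a\<in>A. x \<otimes>\<^bsub>S\<^esub> a = y)},
     tail = fst,
     head = snd\<rparr>"


section \<open>1-paths\<close>

text \<open>A path is its start vertex together with its list of arcs; the start vertex is needed
  to tell the empty paths apart.\<close>

type_synonym ('v, 'e) path1 = "'v \<times> 'e list"

definition path_start :: "('v, 'e) path1 \<Rightarrow> 'v" where
  "path_start p = fst p"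

definition path_end :: "('v, 'e) pre_digraph \<Rightarrow> ('v, 'e) path1 \<Rightarrow> 'v" where
  "path_end G p = last (pre_digraph.awalk_verts G (fst p) (snd p))"

definition path_length :: "('v, 'e) path1 \<Rightarrow> nat" where
  "path_length p = length (snd p)"

definition is_path :: "('v, 'e) pre_digraph \<Rightarrow> ('v, 'e) path1 \<Rightarrow> bool" where
  "is_path G p \<longleftrightarrow> pre_digraph.awalk G (path_start p) (snd p) (path_end G p)"

text \<open>Only meaningful if \<open>p\<close> ends where \<open>q\<close> starts.\<close>

definition path_comp :: "('v, 'e) path1 \<Rightarrow> ('v, 'e) path1 \<Rightarrow> ('v, 'e) path1" where
  "path_comp p q = (fst p, snd p @ snd q)"

definition parallel :: "('v, 'e) pre_digraph \<Rightarrow> ('v, 'e) path1 \<Rightarrow> ('v, 'e) path1 \<Rightarrow> bool" where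
  "parallel G p q \<longleftrightarrow> is_path G p \<and> is_path G q \<and>
    path_start p = path_start q \<and> path_end G p = path_end G q"


section \<open>Directed 2-complexes and 2-paths\<close>

record ('v, 'e, 'f) directed_2complex =
  skeleton :: "('v, 'e) pre_digraph"
  cells :: "'f set"
  cell_top :: "'f \<Rightarrow> ('v, 'e) path1"
  cell_bottom :: "'f \<Rightarrow> ('v, 'e) path1"
  cell_inverse :: "'f \<Rightarrow> 'f"

definition K_complex :: "nat \<Rightarrow> ('v, 'e) pre_digraph
    \<Rightarrow> ('v, 'e, ('v, 'e) path1 \<times> ('v, 'e) path1) directed_2complex" where
  "K_complex n G =
    \<lparr>skeleton = G,
     cells = {(p, q). parallel G p q \<and> path_length p + path_length q \<le> n},
     cell_top = fst,
     cell_bottom = snd,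
     cell_inverse = (\<lambda>(p, q). (q, p))\<rparr>"

type_synonym ('v, 'e, 'f) atomic = "('v, 'e) path1 \<times> 'f \<times> ('v, 'e) path1"

definition is_atomic_2path ::
  "('v, 'e, 'f) directed_2complex \<Rightarrow> ('v, 'e, 'f) atomic \<Rightarrow> bool" where
  "is_atomic_2path K = (\<lambda>(u, f, v).
    is_path (skeleton K) u \<and> f \<in> cells K \<and> is_path (skeleton K) v \<and>
    path_end (skeleton K) u = path_start (cell_top K f) \<and>
    path_start v = path_end (skeleton K) (cell_top K f))"

definition atomic_top ::
  "('v, 'e, 'f) directed_2complex \<Rightarrow> ('v, 'e, 'f) atomic \<Rightarrow> ('v, 'e) path1" where
  "atomic_top K = (\<lambda>(u, f, v). path_comp u (path_comp (cell_top K f) v))"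

definition atomic_bottom ::
  "('v, 'e, 'f) directed_2complex \<Rightarrow> ('v, 'e, 'f) atomic \<Rightarrow> ('v, 'e) path1" where
  "atomic_bottom K = (\<lambda>(u, f, v). path_comp u (path_comp (cell_bottom K f) v))"

text \<open>\<open>is_2path K p ds q\<close>: the sequence \<open>ds\<close> is a 2-path from \<open>p\<close> to \<open>q\<close>. The empty sequence
  is a 2-path from every 1-path to itself.\<close>

fun is_2path :: "('v, 'e, 'f) directed_2complex \<Rightarrow> ('v, 'e) path1
    \<Rightarrow> ('v, 'e, 'f) atomic list \<Rightarrow> ('v, 'e) path1 \<Rightarrow> bool" where
  "is_2path K p [] q \<longleftrightarrow> is_path (skeleton K) p \<and> p = q"
| "is_2path K p (d # ds) q \<longleftrightarrow>
    is_atomic_2path K d \<and> atomic_top K d = p \<and> is_2path K (atomic_bottom K d) ds q"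

definition directed_simply_connected :: "('v, 'e, 'f) directed_2complex \<Rightarrow> bool" where
  "directed_simply_connected K \<longleftrightarrow>
    (\<forall>p q. parallel (skeleton K) p q \<longrightarrow> (\<exists>ds. is_2path K p ds q))"

definition n_quasi_simply_connected :: "nat \<Rightarrow> ('v, 'e) pre_digraph \<Rightarrow> bool" where
  "n_quasi_simply_connected n G \<longleftrightarrow> directed_simply_connected (K_complex n G)"

definition quasi_simply_connected :: "('v, 'e) pre_digraph \<Rightarrow> bool" where
  "quasi_simply_connected G \<longleftrightarrow> (\<exists>n. n_quasi_simply_connected n G)"

end

theory Submission
  imports Defs
begin

text \<open>Consider the monoid with generators \<open>t, a, b, s\<close> (encoded as \<open>0, 1, 2, 3\<close>) and relations
  \<open>taa = ata\<close>, \<open>tbb = btb\<close>, \<open>sta = tas\<close>, \<open>stb = tas\<close>. It satisfies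
  \<open>s t\<^sup>n a\<^sup>n = s (ta)\<^sup>n = (ta)\<^sup>n s = s (tb)\<^sup>n = s t\<^sup>n b\<^sup>n\<close>, but these derivations rewrite the prefix
  \<open>s t\<^sup>n\<close>, which a 2-path between the two paths from \<open>s t\<^sup>n\<close> labelled \<open>a\<^sup>n\<close> and \<open>b\<^sup>n\<close> cannot do.
  Indeed these are the only two paths from \<open>s t\<^sup>n\<close> to \<open>(ta)\<^sup>n s\<close>: the relations preserve length, and
  the monoid acts on the right on the states of a counter that is started by \<open>s\<close>, is
  incremented by \<open>t\<close> and decremented by \<open>a\<close> and \<open>b\<close>, and that, once decremented, insists on the
  same letter until it is back to zero. The two paths have different first and last arcs,
  hence only a 2-cell with boundary of length \<open>2n\<close> can pass from one to the other.\<close>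

section \<open>Parallelism classes consisting of two paths\<close>

text \<open>Passes between \<open>is_path\<close> with its computed \<open>path_end\<close> and
  \<open>awalk\<close> with an explicit end vertex, where composition of walks is available.\<close>

lemma is_path_iff_awalk:
  "is_path G p \<and> path_end G p = v \<longleftrightarrow> pre_digraph.awalk G (fst p) (snd p) v"
proof -
  have "pre_digraph.cas G u es v \<Longrightarrow> last (pre_digraph.awalk_verts G u es) = v" for u es
    by (induction es arbitrary: u)
      (auto simp: pre_digraph.cas.simps pre_digraph.awalk_verts.simps
        pre_digraph.awalk_verts_non_Nil)
  then show ?thesis
    by (auto simp: is_path_def path_end_def path_start_def pre_digraph.awalk_def)
qed

text \<open>Exchanging the middle factor for a parallel path leaves both end vertices fixed.\<close>

lemma atomic_2path_parallel:
  assumes "wf_digraph G" and "is_atomic_2path (K_complex n G) d"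
  shows "parallel G (atomic_top (K_complex n G) d) (atomic_bottom (K_complex n G) d)"
proof -
  interpret wf_digraph G by fact
  obtain u x y v where d: "d = (u, (x, y), v)"
    by (metis surj_pair)
  have "awalk (fst u) (snd u) (fst x)" "awalk (fst x) (snd x) (fst v)"
    "awalk (fst y) (snd y) (fst v)" "awalk (fst v) (snd v) (path_end G v)" "fst x = fst y"
    using assms(2)
      is_path_iff_awalk[of G u] is_path_iff_awalk[of G v]
      is_path_iff_awalk[of G x] is_path_iff_awalk[of G y]
    by (auto simp: d is_atomic_2path_def K_complex_def parallel_def path_start_def)
  then have "awalk (fst u) (snd u @ snd x @ snd v) (path_end G v)"
    "awalk (fst u) (snd u @ snd y @ snd v) (path_end G v)"
    by auto
  then have "is_path G (fst u, snd u @ snd z @ snd v) \<and>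
      path_end G (fst u, snd u @ snd z @ snd v) = path_end G v" if "z = x \<or> z = y" for z
    using is_path_iff_awalk[of G "(fst u, snd u @ snd z @ snd v)"] that by auto
  then show ?thesis
    by (auto simp: parallel_def d atomic_top_def atomic_bottom_def K_complex_def path_comp_def
        path_start_def)
qed

text \<open>Every atomic 2-path with top \<open>p\<close> has bottom \<open>p\<close>: the bottom is
  parallel to \<open>p\<close>, and a cell that leads to \<open>q\<close> would be too long. Hence
  no 2-path leaves \<open>p\<close>.\<close>

lemma not_n_quasi_simply_connectedI:
  assumes "wf_digraph G" and "parallel G p q"
    and only: "\<And>r. parallel G p r \<Longrightarrow> r = p \<or> r = q"
    and hd: "hd (snd p) \<noteq> hd (snd q)" and last: "last (snd p) \<noteq> last (snd q)"
    and long: "n < path_length p + path_length q"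
  shows "\<not> n_quasi_simply_connected n G"
proof
  let ?K = "K_complex n G"
  have step: "atomic_bottom ?K d = p" if d: "is_atomic_2path ?K d" "atomic_top ?K d = p" for d
  proof (rule ccontr)
    assume "atomic_bottom ?K d \<noteq> p"
    then have bottom: "atomic_bottom ?K d = q"
      using only atomic_2path_parallel[OF assms(1) d(1)] d(2) by metis
    obtain u x y v where d_eq: "d = (u, (x, y), v)"
      by (metis surj_pair)
    have arcs: "snd p = snd u @ snd x @ snd v" "snd q = snd u @ snd y @ snd v"
      using d(2) bottom
      by (auto simp: d_eq atomic_top_def atomic_bottom_def K_complex_def path_comp_def)
    \<comment> \<open>A nonempty context \<open>u\<close> or \<open>v\<close> would give
      \<open>p\<close> and \<open>q\<close> a common first or last arc, so the cell contains all
      arcs of both.\<close>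
    have "snd u = []"
      using hd by (cases "snd u") (auto simp: arcs)
    moreover have "snd v = []"
      using last by (cases "snd v" rule: rev_cases) (auto simp: arcs)
    moreover have "path_length x + path_length y \<le> n"
      using d(1) by (auto simp: d_eq is_atomic_2path_def K_complex_def)
    ultimately show False
      using long by (simp add: arcs path_length_def)
  qed
  have fixed: "r = p" if "is_2path ?K p ds r" for ds r
    using that by (induction ds) (auto simp: step)
  assume "n_quasi_simply_connected n G"
  moreover have "skeleton ?K = G"
    by (simp add: K_complex_def)
  ultimately obtain ds where "is_2path ?K p ds q"
    using assms(2) unfolding n_quasi_simply_connected_def directed_simply_connected_def by metis
  then show False
    using fixed hd by blast
qed

section \<open>Presented monoids and their Cayley graphs\<close>

locale monoid_presentation =
  fixes A :: "'g set" and R :: "('g list \<times> 'g list) set"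
  assumes relations: "R \<subseteq> lists A \<times> lists A"
begin

definition cls :: "'g list \<Rightarrow> 'g list set" where
  "cls w = presentation_cong A R `` {w}"

abbreviation "M \<equiv> presented_monoid A R"

abbreviation "generators \<equiv> (\<lambda>g. cls [g]) ` A"

abbreviation "Cay \<equiv> right_cayley_graph M generators"

lemma equiv_presentation_cong: "equiv (lists A) (presentation_cong A R)"
proof (rule equivI)
  have "u \<in> lists A \<and> v \<in> lists A" if "(u, v) \<in> presentation_cong A R" for u v
    using that relations by induction auto
  then show "presentation_cong A R \<subseteq> lists A \<times> lists A"
    by (intro subrelI SigmaI) auto
qed (auto simp: refl_on_def sym_def trans_def
    intro: presentation_cong.refl presentation_cong.sym presentation_cong.trans)

lemma cls_eq_iff:
  "\<lbrakk>u \<in> lists A; v \<in> lists A\<rbrakk> \<Longrightarrow> cls u = cls v \<longleftrightarrow> (u, v) \<in> presentation_cong A R"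
  unfolding cls_def using eq_equiv_class_iff[OF equiv_presentation_cong] .

lemma cls_eqI: "(u, v) \<in> presentation_cong A R \<Longrightarrow> cls u = cls v"
  unfolding cls_def by (rule equiv_class_eq[OF equiv_presentation_cong])

lemma cong_append:
  assumes "(u, u') \<in> presentation_cong A R" "(v, v') \<in> presentation_cong A R"
  shows "(u @ v, u' @ v') \<in> presentation_cong A R"
proof -
  have "u' \<in> lists A" "v \<in> lists A"
    using assms equiv_presentation_cong by (auto dest: equiv_type)
  then have "(u @ v, u' @ v) \<in> presentation_cong A R" "(u' @ v, u' @ v') \<in> presentation_cong A R"
    using presentation_cong.compat[OF assms(1), of "[]" v]
      presentation_cong.compat[OF assms(2), of u' "[]"] by auto
  then show ?thesis
    by (rule presentation_cong.trans)
qed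

lemma carrier_M: "carrier M = cls ` lists A"
  by (auto simp: presented_monoid_def quotient_def cls_def)

lemma one_M: "\<one>\<^bsub>M\<^esub> = cls []"
  by (simp add: presented_monoid_def cls_def)

lemma mult_M:
  assumes "u \<in> lists A" "v \<in> lists A"
  shows "cls u \<otimes>\<^bsub>M\<^esub> cls v = cls (u @ v)"
proof -
  \<comment> \<open>The product is a union over all pairs of representatives. All its terms
    coincide, and \<open>u\<close>, \<open>v\<close> show that there is at least one.\<close>
  have "cls (x @ y) = cls (u @ v)" if "x \<in> cls u" "y \<in> cls v" for x y
    using that cong_append[of u x v y] by (simp add: cls_def[of u] cls_def[of v] cls_eqI)
  then have "(\<Union>x\<in>cls u. \<Union>y\<in>cls v. cls (x @ y)) = (\<Union>x\<in>cls u. \<Union>y\<in>cls v. cls (u @ v))"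
    by simp
  moreover have "u \<in> cls u" "v \<in> cls v"
    using assms by (auto simp: cls_def intro: presentation_cong.refl)
  ultimately have "(\<Union>x\<in>cls u. \<Union>y\<in>cls v. cls (x @ y)) = cls (u @ v)"
    by auto
  then show ?thesis
    by (simp add: presented_monoid_def cls_def)
qed

lemma monoid_M: "monoid M"
proof
  show "x \<otimes>\<^bsub>M\<^esub> y \<in> carrier M" if "x \<in> carrier M" "y \<in> carrier M" for x y
    using that unfolding carrier_M by (elim imageE) (simp add: mult_M)
  show "x \<otimes>\<^bsub>M\<^esub> y \<otimes>\<^bsub>M\<^esub> z = x \<otimes>\<^bsub>M\<^esub> (y \<otimes>\<^bsub>M\<^esub> z)"
    if "x \<in> carrier M" "y \<in> carrier M" "z \<in> carrier M" for x y z
    using that unfolding carrier_M by (elim imageE) (simp add: mult_M)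
  show "\<one>\<^bsub>M\<^esub> \<otimes>\<^bsub>M\<^esub> x = x" "x \<otimes>\<^bsub>M\<^esub> \<one>\<^bsub>M\<^esub> = x" if "x \<in> carrier M" for x
    using that unfolding carrier_M one_M by (elim imageE, simp add: mult_M)+
qed (auto simp: carrier_M one_M)

lemma generates_M: "generates_monoid M generators"
  unfolding generates_monoid_def
proof
  show sub: "generators \<subseteq> carrier M"
    by (auto simp: carrier_M)
  have "cls w \<in> H" if H: "submonoid H M" "generators \<subseteq> H" and w: "w \<in> lists A" for H w
    using w
  proof (induction w rule: lists.induct)
    case Nil
    then show ?case
      using submonoid.one_closed[OF H(1)] by (simp add: one_M)
  next
    case (Cons g w)
    then have "cls [g] \<otimes>\<^bsub>M\<^esub> cls w \<in> H"
      using H by (blast intro: submonoid.m_closed)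
    then show ?case
      using Cons by (simp add: mult_M)
  qed
  then have "carrier M \<subseteq> (\<lambda>H. submonoid H M) hull generators"
    by (auto simp: hull_def carrier_M)
  moreover have "submonoid (carrier M) M"
    using monoid_M by unfold_locales (auto intro: monoid.m_closed monoid.one_closed)
  then have "(\<lambda>H. submonoid H M) hull generators \<subseteq> carrier M"
    using sub by (rule hull_minimal[rotated])
  ultimately show "(\<lambda>H. submonoid H M) hull generators = carrier M"
    by blast
qed

section \<open>Walks in the Cayley graph and their labels\<close>

lemma wf_digraph_Cay: "wf_digraph Cay"
  by unfold_locales (auto simp: right_cayley_graph_def)

lemma tail_head_Cay [simp]: "tail Cay = fst" "head Cay = snd"
  by (simp_all add: right_cayley_graph_def)

lemma arc_Cay_iff:
  "(x, y) \<in> arcs Cay \<longleftrightarrow> (\<exists>w\<in>lists A. \<exists>g\<in>A. x = cls w \<and> y = cls (w @ [g]))"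
proof
  assume "(x, y) \<in> arcs Cay"
  then have "x \<in> carrier M" "\<exists>g\<in>A. x \<otimes>\<^bsub>M\<^esub> cls [g] = y"
    by (auto simp: right_cayley_graph_def)
  then obtain w g where "w \<in> lists A" "g \<in> A" "x = cls w" "y = x \<otimes>\<^bsub>M\<^esub> cls [g]"
    unfolding carrier_M by blast
  then show "\<exists>w\<in>lists A. \<exists>g\<in>A. x = cls w \<and> y = cls (w @ [g])"
    by (intro bexI[of _ w] bexI[of _ g]) (simp_all add: mult_M)
next
  assume "\<exists>w\<in>lists A. \<exists>g\<in>A. x = cls w \<and> y = cls (w @ [g])"
  then obtain w g where "w \<in> lists A" "g \<in> A" "x = cls w" "y = cls (w @ [g])"
    by blast
  moreover from this have "x \<otimes>\<^bsub>M\<^esub> cls [g] = y"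
    by (simp add: mult_M)
  ultimately show "(x, y) \<in> arcs Cay"
    by (auto simp: right_cayley_graph_def carrier_M)
qed

text \<open>The position is carried as a word, so that following an arc is appending a letter. Arcs
  are bare vertex pairs, so different labels can describe the same walk.\<close>

fun labelled_arcs :: "'g list \<Rightarrow> 'g list \<Rightarrow> ('g list set \<times> 'g list set) list" where
  "labelled_arcs w [] = []"
| "labelled_arcs w (g # u) = (cls w, cls (w @ [g])) # labelled_arcs (w @ [g]) u"

lemma length_labelled_arcs [simp]: "length (labelled_arcs w u) = length u"
  by (induction u arbitrary: w) auto

lemma labelled_arcs_append:
  "labelled_arcs w (u @ v) = labelled_arcs w u @ labelled_arcs (w @ u) v"
  by (induction u arbitrary: w) auto

lemma awalk_labelled_arcs:
  assumes "w \<in> lists A" "u \<in> lists A"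
  shows "pre_digraph.awalk Cay (cls w) (labelled_arcs w u) (cls (w @ u))"
proof -
  interpret wf_digraph Cay by (rule wf_digraph_Cay)
  show ?thesis
    using assms(2,1)
  proof (induction arbitrary: w rule: lists.induct)
    case Nil
    then show ?case
      by (simp add: awalk_Nil_iff) (simp add: right_cayley_graph_def carrier_M)
  next
    case (Cons g u)
    then have "awalk (cls (w @ [g])) (labelled_arcs (w @ [g]) u) (cls (w @ g # u))"
      using Cons.IH[of "w @ [g]"] by simp
    moreover have "(cls w, cls (w @ [g])) \<in> arcs Cay"
      using Cons unfolding arc_Cay_iff by blast
    ultimately show ?case
      by (simp add: awalk_Cons_iff)
  qed
qed

lemma awalk_CayE:
  assumes "pre_digraph.awalk Cay (cls w) es y" "w \<in> lists A"
  obtains u where "u \<in> lists A" "es = labelled_arcs w u" "y = cls (w @ u)"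
proof -
  interpret wf_digraph Cay by (rule wf_digraph_Cay)
  have "\<exists>u \<in> lists A. es = labelled_arcs w u \<and> y = cls (w @ u)"
    using assms
  proof (induction es arbitrary: w)
    case Nil
    then show ?case
      by (auto simp: awalk_Nil_iff intro!: bexI[of _ "[]"])
  next
    case (Cons e es)
    have e: "e \<in> arcs Cay" "fst e = cls w" and es: "awalk (snd e) es y"
      using Cons.prems by (auto simp: awalk_Cons_iff)
    obtain w' g where w': "w' \<in> lists A" "g \<in> A" "e = (cls w', cls (w' @ [g]))"
      using e(1) arc_Cay_iff by (cases e) auto
    \<comment> \<open>The arc comes with some representative \<open>w'\<close> of its tail; the
      congruence lets \<open>w\<close> replace it.\<close>
    then have "(w', w) \<in> presentation_cong A R"
      using e(2) Cons.prems(2) by (simp add: cls_eq_iff)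
    then have "cls (w' @ [g]) = cls (w @ [g])"
      using w'(2) by (intro cls_eqI cong_append) (simp_all add: presentation_cong.refl)
    then have "e = (cls w, cls (w @ [g]))"
      using w' e(2) by simp
    moreover from this obtain u where "u \<in> lists A" "es = labelled_arcs (w @ [g]) u"
      "y = cls (w @ [g] @ u)"
      using Cons.IH[of "w @ [g]"] es Cons.prems(2) w'(2) by auto
    ultimately show ?case
      using w'(2) by (intro bexI[of _ "g # u"]) auto
  qed
  then show thesis
    using that by blast
qed

end

section \<open>The counterexample\<close>

definition letters :: "nat set" where
  "letters = {0, 1, 2, 3}"

definition rels :: "(nat list \<times> nat list) set" where
  "rels = {([0, 1, 1], [1, 0, 1]), ([0, 2, 2], [2, 0, 2]),
    ([3, 0, 1], [0, 1, 3]), ([3, 0, 2], [0, 1, 3])}"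

interpretation ex: monoid_presentation letters rels
  by unfold_locales (auto simp: rels_def letters_def)

section \<open>The counter automaton\<close>

text \<open>In \<open>Level h c\<close>, \<open>c\<close> is the letter, if any, on which the next decrements must be made.\<close>

datatype state = Idle | Level nat "nat option" | Dead

text \<open>Letters before the first s are ignored. Clearing the letter at zero makes sta, stb and
  tas agree from \<open>Idle\<close>; from any level all three end in \<open>Dead\<close>.\<close>

fun step :: "nat \<Rightarrow> state \<Rightarrow> state" where
  "step x Idle = (if x = 3 then Level 0 None else Idle)"
| "step x Dead = Dead"
| "step x (Level h c) =
    (if x = 0 then Level (Suc h) c
     else if x = 3 \<or> h = 0 \<or> c \<notin> {None, Some x} then Dead
     else Level (h - 1) (if h = 1 then None else Some x))"

text \<open>Only the four relations need checking, in every state: \<open>fold step\<close> turns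
  concatenation into composition, so the other rules preserve equality of actions.\<close>

lemma fold_step_cong:
  "(u, v) \<in> presentation_cong letters rels \<Longrightarrow> fold step u q = fold step v q"
proof (induction arbitrary: q rule: presentation_cong.induct)
  case (base u v)
  then show ?case
    by (cases q) (auto simp: rels_def)
qed auto

lemma length_cong: "(u, v) \<in> presentation_cong letters rels \<Longrightarrow> length u = length v"
  by (induction rule: presentation_cong.induct) (auto simp: rels_def)

lemma fold_step_Dead [simp]: "fold step u Dead = Dead"
  by (induction u) auto

lemma step_increments [simp]: "(step 0 ^^ n) (Level h c) = Level (h + n) c"
  by (induction n) auto

lemma step_decrements:
  assumes "x \<in> {1, 2}" "k < h"
  shows "(step x ^^ k) (Level h None) = Level (h - k) (if k = 0 then None else Some x)"
  using assms by (induction k) auto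

text \<open>A letter lowers the level by at most one, and \<open>Dead\<close> never returns to a
  level.\<close>

lemma level_decrease:
  "fold step u (Level h c) = Level k c' \<Longrightarrow> h \<le> k + length u"
proof (induction u arbitrary: h c)
  case (Cons x u)
  show ?case
    using Cons.IH[of "Suc h" c] Cons.IH[of "h - 1" "if h = 1 then None else Some x"] Cons.prems
    by (auto split: if_splits)
qed simp

lemma fastest_decrease_Some:
  assumes "fold step u (Level h (Some x)) = Level 0 None" "length u = h"
  shows "u = replicate h x"
  using assms
proof (induction u arbitrary: h)
  case (Cons y u)
  then show ?case
    \<comment> \<open>\<open>Suc h\<close> is the level after an increment, from which the remaining
      \<open>h - 1\<close> letters cannot reach zero. So only decrements on the fixed letter
      \<open>x\<close> are left.\<close>
    using level_decrease[of u "Suc h" "Some x" 0 None]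
    by (cases u) (auto split: if_splits)
qed simp

text \<open>At the first letter, s is fatal and t wastes time; the choice between a and b is binding
  until zero.\<close>

lemma fastest_decrease:
  assumes "fold step u (Level h None) = Level 0 None" "length u = h" "u \<in> lists letters"
  shows "u = replicate h 1 \<or> u = replicate h 2"
proof (cases u)
  case (Cons y v)
  then show ?thesis
    using assms level_decrease[of v "Suc h" "None" 0 None] fastest_decrease_Some[of v "h - 1" y]
    by (cases v) (auto simp: letters_def split: if_splits)
qed (use assms in auto)

section \<open>Derivations that identify the ends of the two branches\<close>

abbreviation start_word :: "nat \<Rightarrow> nat list" where
  "start_word n \<equiv> 3 # replicate n 0"

abbreviation zigzag :: "nat \<Rightarrow> nat \<Rightarrow> nat list" where
  "zigzag x n \<equiv> concat (replicate n [0, x])"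

abbreviation end_word :: "nat \<Rightarrow> nat list" where
  "end_word n \<equiv> zigzag 1 n @ [3]"

lemma in_lists_letters:
  "x \<in> {1, 2} \<Longrightarrow> replicate n x \<in> lists letters"
  "start_word n \<in> lists letters"
  by (auto simp: letters_def split: if_splits)

lemmas [trans] = presentation_cong.trans

text \<open>The last x moves left past one block at a time, since txx = xtx.\<close>

lemma zigzag_commute:
  assumes "x \<in> {1, 2}"
  shows "(zigzag x n @ [x], x # zigzag x n) \<in> presentation_cong letters rels"
proof (induction n)
  case 0
  show ?case
    using assms by (auto intro!: presentation_cong.refl simp: letters_def)
next
  case (Suc n)
  have "(zigzag x (Suc n) @ [x], [0, x, x] @ zigzag x n) \<in> presentation_cong letters rels"
    using presentation_cong.compat[OF Suc, of "[0, x]" "[]"] assms by (auto simp: letters_def)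
  also have "([0, x, x] @ zigzag x n, [x, 0, x] @ zigzag x n) \<in> presentation_cong letters rels"
    using assms by (intro ex.cong_append[OF presentation_cong.base presentation_cong.refl])
      (auto simp: rels_def letters_def split: if_splits)
  finally show ?case
    by simp
qed

text \<open>Induction from the inside out: \<open>zigzag_commute\<close> moves the new outer x next
  to the new outer t.\<close>

lemma peak_zigzag:
  assumes "x \<in> {1, 2}"
  shows "(replicate n 0 @ replicate n x, zigzag x n) \<in> presentation_cong letters rels"
proof (induction n)
  case 0
  show ?case
    by (auto intro!: presentation_cong.refl)
next
  case (Suc n)
  have "replicate (Suc n) 0 @ replicate (Suc n) x = [0] @ (replicate n 0 @ replicate n x) @ [x]"
    by (simp add: replicate_append_same)
  also have "(\<dots>, [0] @ zigzag x n @ [x]) \<in> presentation_cong letters rels"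
    using assms by (intro presentation_cong.compat[OF Suc]) (auto simp: letters_def)
  also have "([0] @ zigzag x n @ [x], [0] @ x # zigzag x n) \<in> presentation_cong letters rels"
    using presentation_cong.compat[OF zigzag_commute[OF assms], of "[0]" "[]"]
    by (auto simp: letters_def)
  finally show ?case
    by simp
qed

text \<open>Moving s to the right turns each block tx into ta, whichever letter x is; this is where
  the a-branch and the b-branch are identified.\<close>

lemma zigzag_marker:
  assumes "x \<in> {1, 2}"
  shows "(3 # zigzag x n, end_word n) \<in> presentation_cong letters rels"
proof (induction n)
  case 0
  show ?case
    by (auto intro!: presentation_cong.refl simp: letters_def)
next
  case (Suc n)
  have "([3, 0, x] @ zigzag x n, [0, 1, 3] @ zigzag x n) \<in> presentation_cong letters rels"
    using assms by (intro ex.cong_append[OF presentation_cong.base presentation_cong.refl])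
      (auto simp: rels_def letters_def split: if_splits)
  also have "([0, 1, 3] @ zigzag x n, [0, 1] @ end_word n) \<in> presentation_cong letters rels"
    using presentation_cong.compat[OF Suc, of "[0, 1]" "[]"] by (auto simp: letters_def)
  finally show ?case
    by simp
qed

lemma start_word_end_word:
  assumes "x \<in> {1, 2}"
  shows "ex.cls (start_word n @ replicate n x) = ex.cls (end_word n)"
proof -
  have "([3] @ (replicate n 0 @ replicate n x), [3] @ zigzag x n) \<in> presentation_cong letters rels"
    using presentation_cong.compat[OF peak_zigzag[OF assms], of "[3]" "[]"]
    by (auto simp: letters_def)
  also have "([3] @ zigzag x n, end_word n) \<in> presentation_cong letters rels"
    using zigzag_marker[OF assms] by simp
  finally show ?thesis
    using ex.cls_eqI by simp
qed

section \<open>The two paths from the start word to the end word\<close>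

lemma fold_step_end_word: "fold step (end_word n) Idle = Level 0 None"
  by (induction n) auto

lemma labels_start_end:
  assumes "u \<in> lists letters" "ex.cls (start_word n @ u) = ex.cls (end_word n)"
  shows "u = replicate n 1 \<or> u = replicate n 2"
proof -
  have cong: "(start_word n @ u, end_word n) \<in> presentation_cong letters rels"
    using assms by (subst (asm) ex.cls_eq_iff) (auto simp: letters_def split: if_splits)
  have "length u = n"
    using length_cong[OF cong] by (simp add: length_concat sum_list_replicate)
  \<comment> \<open>From \<open>Idle\<close>, the prefix \<open>start_word n\<close> leads to
    \<open>Level n None\<close>; in \<open>end_word n\<close> everything before the final s is
    ignored.\<close>
  moreover have "fold step u (Level n None) = Level 0 None"
    using fold_step_cong[OF cong, of Idle] fold_step_end_word by simp
  ultimately show ?thesis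
    using fastest_decrease assms(1) by blast
qed

text \<open>Strictly inside the descent the counter still remembers the letter. At
  \<open>k = 0\<close> and at \<open>k = n\<close> the two vertices coincide.\<close>

lemma branches_disjoint:
  assumes "0 < k" "k < n"
  shows "ex.cls (start_word n @ replicate k 1) \<noteq> ex.cls (start_word n @ replicate k 2)"
proof
  assume "ex.cls (start_word n @ replicate k 1) = ex.cls (start_word n @ replicate k 2)"
  then have "(start_word n @ replicate k 1, start_word n @ replicate k 2)
      \<in> presentation_cong letters rels"
    by (subst (asm) ex.cls_eq_iff) (auto simp: letters_def)
  from fold_step_cong[OF this, of Idle] show False
    using assms step_decrements[of 1 k n] step_decrements[of 2 k n] by simp
qed

lemma not_n_quasi_simply_connected_example: "\<not> n_quasi_simply_connected n ex.Cay"
proof -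
  \<comment> \<open>As \<open>m\<close> is at least 2, \<open>branches_disjoint\<close> applies to
    \<open>k = 1\<close> and \<open>k = m - 1\<close>; the two lengths add up to 2m > n.\<close>
  define m where "m = n + 2"
  define br where
    "br x = (ex.cls (start_word m), ex.labelled_arcs (start_word m) (replicate m x))" for x
  have awalk_br:
    "pre_digraph.awalk ex.Cay (ex.cls (start_word m)) (snd (br x)) (ex.cls (end_word m))"
    if "x \<in> {1, 2}" for x
    using ex.awalk_labelled_arcs[OF in_lists_letters(2) in_lists_letters(1)[OF that], of m m]
    by (simp only: start_word_end_word[OF that] br_def snd_conv)
  have path_br: "is_path ex.Cay (br x) \<and> path_end ex.Cay (br x) = ex.cls (end_word m)"
    if "x \<in> {1, 2}" for x
    using awalk_br[OF that] is_path_iff_awalk[of ex.Cay "br x"] by (simp add: br_def)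
  \<comment> \<open>The first arcs share their tail and are separated by their heads; the last arcs
    share their head and are separated by their tails.\<close>
  have hd: "hd (snd (br x)) = (ex.cls (start_word m), ex.cls (start_word m @ replicate 1 x))" for x
    by (simp add: br_def m_def)
  have "replicate m x = replicate (m - 1) x @ [x]" for x :: nat
    by (simp add: m_def replicate_append_same)
  then have last: "fst (last (snd (br x))) = ex.cls (start_word m @ replicate (m - 1) x)" for x
    by (simp add: br_def ex.labelled_arcs_append)
  show ?thesis
  proof (rule not_n_quasi_simply_connectedI)
    show "wf_digraph ex.Cay"
      by (rule ex.wf_digraph_Cay)
    show "parallel ex.Cay (br 1) (br 2)"
      using path_br by (simp add: parallel_def path_start_def br_def)
    show "r = br 1 \<or> r = br 2" if "parallel ex.Cay (br 1) r" for r
    proof -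
      have start: "fst r = ex.cls (start_word m)"
        using that by (simp add: parallel_def path_start_def br_def)
      have "pre_digraph.awalk ex.Cay (fst r) (snd r) (ex.cls (end_word m))"
        using that path_br[of 1] is_path_iff_awalk[of ex.Cay r "ex.cls (end_word m)"]
        by (simp add: parallel_def)
      then obtain u where u: "u \<in> lists letters" "snd r = ex.labelled_arcs (start_word m) u"
        "ex.cls (end_word m) = ex.cls (start_word m @ u)"
        unfolding start by (rule ex.awalk_CayE[OF _ in_lists_letters(2)])
      then have "u = replicate m 1 \<or> u = replicate m 2"
        by (intro labels_start_end) simp_all
      then show ?thesis
        using start u(2) by (auto simp: br_def prod_eq_iff)
    qed
    show "hd (snd (br 1)) \<noteq> hd (snd (br 2))"
      using branches_disjoint[of 1 m] unfolding hd by (simp add: m_def)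
    show "last (snd (br 1)) \<noteq> last (snd (br 2))"
      using branches_disjoint[of "m - 1" m] last[of 1] last[of 2] by (auto simp: m_def)
    show "n < path_length (br 1) + path_length (br 2)"
      by (simp add: path_length_def br_def m_def)
  qed
qed

theorem proposition4p3:
  shows "\<exists>(S :: nat list set monoid) A. finitely_presented S \<and>
    finite A \<and> generates_monoid S A \<and>
    \<not> quasi_simply_connected (right_cayley_graph S A)"
proof (intro exI conjI)
  \<comment> \<open>The witness is the presented monoid itself, so the identity serves as
    isomorphism.\<close>
  show "finitely_presented ex.M"
    unfolding finitely_presented_def defined_by_presentation_def
    using ex.monoid_M ex.relations by (intro exI[of _ letters] exI[of _ rels])
      (auto simp: letters_def rels_def iso_refl)
  show "finite ex.generators"
    by (simp add: letters_def)
  show "generates_monoid ex.M ex.generators"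
    by (rule ex.generates_M)
  show "\<not> quasi_simply_connected ex.Cay"
    using not_n_quasi_simply_connected_example by (simp add: quasi_simply_connected_def)
qed

end
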